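(* The algebra $\mathcal{O}_{q,P,Q}(M(n))$ is a bi-character deformation of the coordinate algebra $D_q(n)$ of the quantum matrix space of Dipper–Donkin.
   Context: Let $q$, $p_{ij}$, $q_{ij}$ ($1\le i<j\le n$) be independent variables, $K=\mathbb{Q}(q,p_{ij},q_{ij}\mid i<j)$, and set $p_{ii}=q_{ii}=1$, $p_{ji}=p_{ij}^{-1}$, $q_{ji}=q_{ij}^{-1}$. The algebra $\mathcal{O}_{q,P,Q}(M(n))$ is the associative unital $K$-algebra with generators $Z_{ij}$ ($1\le i,j\le n$) and relations $Z_{st}Z_{ij}=p_{si}^2q_{tj}^2Z_{ij}Z_{st}+(q^2-1)p_{si}^2Z_{it}Z_{sj}$ if $s>i,\ t>j$; $Z_{st}Z_{ij}=q^2p_{si}^2q_{jt}^{-2}Z_{ij}Z_{st}$ if $s>i,\ t\le j$; $Z_{it}Z_{ij}=q_{tj}^2Z_{ij}Z_{it}$ for all $i,j,t$. The algebra $D_q(n)$ is the associative unital $K$-algebra with generators $Z_{ij}$ ($1\le i,j\le n$) and relations $Z_{st}Z_{ij}=Z_{ij}Z_{st}+(q^2-1)Z_{it}Z_{sj}$ if $s>i,\ t>j$; $Z_{st}Z_{ij}=q^2Z_{ij}Z_{st}$ if $s>i,\ t\le j$; $Z_{it}Z_{ij}=Z_{ij}Z_{it}$ for all $i,j,t$. Bi-character deformation: let $G$ be an abelian semigroup (written additively). A bi-character of $G$ is a map $G\times G\to K^*$ that is a semigroup homomorphism in each variable. Let $A=\bigoplus_{g,h\in G}A_{g,h}$ be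 an associative algebra with $A_{g_1,h_1}A_{g_2,h_2}\subset A_{g_1+g_2,h_1+h_2}$, and let $\phi,\psi$ be bi-characters of $G$. The vector space $A$ with the new associative multiplication $a*b=\phi(g_1,g_2)\psi(h_1,h_2)\,ab$ for $a\in A_{g_1,h_1}$, $b\in A_{g_2,h_2}$ is called a bi-character deformation of $A$. The claim means that $\mathcal{O}_{q,P,Q}(M(n))$ is isomorphic as a $K$-algebra to such a deformation of $D_q(n)$. *)

theory Defs
  imports
    "HOL-Algebra.Algebraic_Closure_Type"
    "HOL-Algebra.Module"
    "HOL-Library.Poly_Mapping"
    "HOL-Library.Option_ord"
    "HOL-Library.Product_Lexorder"
begin

text \<open>
  The index set \<open>{1, ..., n}\<close> is an arbitrary finite linearly ordered type \<open>'n\<close>, and \<open>n\<close> is the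
  cardinality of \<open>'n\<close>.
\<close>

section \<open>The base field\<close>

text \<open>
  The indeterminates: \<open>None\<close> stands for \<open>q\<close>, \<open>Some (False, i, j)\<close> for \<open>p\<^sub>i\<^sub>j\<close> and \<open>Some (True, i, j)\<close>
  for \<open>q\<^sub>i\<^sub>j\<close>, the latter two only for \<open>i < j\<close>.  The linear order on them has no mathematical meaning;
  the library needs it to see that the polynomial ring is an integral domain.
\<close>

typedef (overloaded) 'n indet =
  "{v :: (bool \<times> 'n::linorder \<times> 'n) option. \<forall>b i j. v = Some (b, i, j) \<longrightarrow> i < j}"
  by (rule exI[of _ None]) simp

instantiation indet :: (linorder) linorder
begin

definition less_eq_indet :: "'a indet \<Rightarrow> 'a indet \<Rightarrow> bool"
  where "less_eq_indet u v \<longleftrightarrow> Rep_indet u \<le> Rep_indet v"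

definition less_indet :: "'a indet \<Rightarrow> 'a indet \<Rightarrow> bool"
  where "less_indet u v \<longleftrightarrow> Rep_indet u < Rep_indet v"

instance
  by standard (auto simp: less_eq_indet_def less_indet_def simp flip: Rep_indet_inject)

end

text \<open>Polynomials over the rationals are finitely supported functions on monomials; \<open>K\<close> is their fraction field.\<close>

type_synonym 'n rat_fun = "(('n indet \<Rightarrow>\<^sub>0 nat) \<Rightarrow>\<^sub>0 rat) fract"

definition indet_fract :: "'n::linorder indet \<Rightarrow> 'n rat_fun"
  where "indet_fract v = Fract (Poly_Mapping.single (Poly_Mapping.single v 1) 1) 1"

definition qvar :: "'n::linorder rat_fun"
  where "qvar = indet_fract (Abs_indet None)"

definition multiparam :: "bool \<Rightarrow> 'n::linorder \<Rightarrow> 'n \<Rightarrow> 'n rat_fun"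
  where "multiparam b i j =
    (if i < j then indet_fract (Abs_indet (Some (b, i, j)))
     else if i = j then 1
     else inverse (indet_fract (Abs_indet (Some (b, j, i)))))"

abbreviation Pvar :: "'n::linorder \<Rightarrow> 'n \<Rightarrow> 'n rat_fun"
  where "Pvar \<equiv> multiparam False"

abbreviation Qvar :: "'n::linorder \<Rightarrow> 'n \<Rightarrow> 'n rat_fun"
  where "Qvar \<equiv> multiparam True"


section \<open>Unital associative algebras given by generators and relations\<close>

locale assoc_algebra =
  fixes K :: "('k, 'c) ring_scheme" and A :: "('k, 'a, 'd) module_scheme"
  assumes scalar_field: "field K"
    and vector_space: "module K A"
    and unital_ring: "ring A"
    and smult_mult_left: "\<lbrakk>c \<in> carrier K; x \<in> carrier A; y \<in> carrier A\<rbrakk> \<Longrightarrow>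
      (c \<odot>\<^bsub>A\<^esub> x) \<otimes>\<^bsub>A\<^esub> y = c \<odot>\<^bsub>A\<^esub> (x \<otimes>\<^bsub>A\<^esub> y)"
    and smult_mult_right: "\<lbrakk>c \<in> carrier K; x \<in> carrier A; y \<in> carrier A\<rbrakk> \<Longrightarrow>
      x \<otimes>\<^bsub>A\<^esub> (c \<odot>\<^bsub>A\<^esub> y) = c \<odot>\<^bsub>A\<^esub> (x \<otimes>\<^bsub>A\<^esub> y)"

definition algebra_iso ::
    "('k, 'c) ring_scheme \<Rightarrow> ('k, 'a, 'd) module_scheme \<Rightarrow> ('k, 'b, 'e) module_scheme \<Rightarrow> ('a \<Rightarrow> 'b) set"
  where "algebra_iso K A B =
    {f \<in> ring_iso A B. \<forall>c\<in>carrier K. \<forall>x\<in>carrier A. f (c \<odot>\<^bsub>A\<^esub> x) = c \<odot>\<^bsub>B\<^esub> f x}"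

text \<open>
  The free monoid, written additively, so that \<open>'x word \<Rightarrow>\<^sub>0 'k\<close> with the multiplication of
  finitely supported functions is its monoid algebra, that is, the free associative algebra.
\<close>

datatype 'x word = Word (letters: "'x list")

instantiation word :: (type) monoid_add
begin

definition zero_word :: "'a word" where "0 = Word []"

definition plus_word :: "'a word \<Rightarrow> 'a word \<Rightarrow> 'a word"
  where "u + v = Word (letters u @ letters v)"

instance
  by standard (auto simp: zero_word_def plus_word_def)

end

type_synonym ('x, 'k) free_alg = "'x word \<Rightarrow>\<^sub>0 'k"

definition gen :: "'x \<Rightarrow> ('x, 'k::field) free_alg"
  where "gen x = Poly_Mapping.single (Word [x]) 1"

definition scale :: "'k::field \<Rightarrow> ('x, 'k) free_alg \<Rightarrow> ('x, 'k) free_alg"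
  where "scale c f = Poly_Mapping.map ((*) c) f"

definition free_algebra :: "('k::field, ('x, 'k) free_alg) module"
  where "free_algebra = ring.extend ring_of_type_algebra (module.fields scale)"

definition quotient_algebra :: "('k, 'a, 'd) module_scheme \<Rightarrow> 'a set \<Rightarrow> ('k, 'a set) module"
  where "quotient_algebra A I =
    ring.extend (A Quot I) (module.fields (\<lambda>c C. \<Union>x\<in>C. I +>\<^bsub>A\<^esub> (c \<odot>\<^bsub>A\<^esub> x)))"

text \<open>A relation \<open>u = v\<close> is given as the element \<open>u - v\<close>; \<^const>\<open>genideal\<close> is the two-sided ideal generated.\<close>

definition presented_algebra :: "('x, 'k::field) free_alg set \<Rightarrow> ('k, ('x, 'k) free_alg set) module"
  where "presented_algebra R = quotient_algebra free_algebra (genideal free_algebra R)"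


section \<open>The quantum matrix algebras\<close>

abbreviation Z :: "'n \<Rightarrow> 'n \<Rightarrow> ('n \<times> 'n, 'k::field) free_alg"
  where "Z i j \<equiv> gen (i, j)"

definition multiparam_relations ::
    "'k::field \<Rightarrow> ('n::linorder \<Rightarrow> 'n \<Rightarrow> 'k) \<Rightarrow> ('n \<Rightarrow> 'n \<Rightarrow> 'k) \<Rightarrow> ('n \<times> 'n, 'k) free_alg set"
  where "multiparam_relations q p r =
    {Z s t * Z i j - (scale ((p s i)\<^sup>2 * (r t j)\<^sup>2) (Z i j * Z s t)
                      + scale ((q\<^sup>2 - 1) * (p s i)\<^sup>2) (Z i t * Z s j)) | s t i j. s > i \<and> t > j} \<union>
    {Z s t * Z i j - scale (q\<^sup>2 * (p s i)\<^sup>2 * inverse ((r j t)\<^sup>2)) (Z i j * Z s t)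
       | s t i j. s > i \<and> t \<le> j} \<union>
    {Z i t * Z i j - scale ((r t j)\<^sup>2) (Z i j * Z i t) | i j t. True}"

definition Dipper_Donkin_relations :: "'k::field \<Rightarrow> ('n::linorder \<times> 'n, 'k) free_alg set"
  where "Dipper_Donkin_relations q =
    {Z s t * Z i j - (Z i j * Z s t + scale (q\<^sup>2 - 1) (Z i t * Z s j)) | s t i j. s > i \<and> t > j} \<union>
    {Z s t * Z i j - scale (q\<^sup>2) (Z i j * Z s t) | s t i j. s > i \<and> t \<le> j} \<union>
    {Z i t * Z i j - Z i j * Z i t | i j t. True}"

type_synonym 'n matrix_algebra =
  "('n rat_fun, ('n \<times> 'n, 'n rat_fun) free_alg set) module"

definition O_qPQ :: "'n::{finite,linorder} matrix_algebra"
  where "O_qPQ = presented_algebra (multiparam_relations qvar Pvar Qvar)"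

definition D_q :: "'n::{finite,linorder} matrix_algebra"
  where "D_q = presented_algebra (Dipper_Donkin_relations qvar)"


section \<open>Bi-character deformations\<close>

locale abelian_semigroup =
  fixes G :: "'g set" and gadd :: "'g \<Rightarrow> 'g \<Rightarrow> 'g"
  assumes add_closed: "\<lbrakk>g \<in> G; h \<in> G\<rbrakk> \<Longrightarrow> gadd g h \<in> G"
    and add_assoc: "\<lbrakk>g \<in> G; h \<in> G; k \<in> G\<rbrakk> \<Longrightarrow> gadd (gadd g h) k = gadd g (gadd h k)"
    and add_comm: "\<lbrakk>g \<in> G; h \<in> G\<rbrakk> \<Longrightarrow> gadd g h = gadd h g"

definition bicharacter ::
    "('k, 'c) ring_scheme \<Rightarrow> 'g set \<Rightarrow> ('g \<Rightarrow> 'g \<Rightarrow> 'g) \<Rightarrow> ('g \<Rightarrow> 'g \<Rightarrow> 'k) \<Rightarrow> bool"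
  where "bicharacter K G gadd \<phi> \<longleftrightarrow>
    (\<forall>g\<in>G. \<forall>h\<in>G. \<phi> g h \<in> Units K) \<and>
    (\<forall>g\<in>G. \<forall>g'\<in>G. \<forall>h\<in>G. \<phi> (gadd g g') h = \<phi> g h \<otimes>\<^bsub>K\<^esub> \<phi> g' h) \<and>
    (\<forall>g\<in>G. \<forall>h\<in>G. \<forall>h'\<in>G. \<phi> g (gadd h h') = \<phi> g h \<otimes>\<^bsub>K\<^esub> \<phi> g h')"

text \<open>In the axiom \<open>direct_sum\<close>, \<open>c (g, h)\<close> is the component of \<open>a\<close> of bidegree \<open>(g, h)\<close>.\<close>

locale bigraded_algebra = assoc_algebra K A + abelian_semigroup G gadd
  for K :: "('k, 'c) ring_scheme" and A :: "('k, 'a, 'd) module_scheme"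
    and G :: "'g set" and gadd :: "'g \<Rightarrow> 'g \<Rightarrow> 'g" +
  fixes gr :: "'g \<Rightarrow> 'g \<Rightarrow> 'a set"
  assumes comp_subspace: "\<lbrakk>g \<in> G; h \<in> G\<rbrakk> \<Longrightarrow> submodule (gr g h) K A"
    and direct_sum: "a \<in> carrier A \<Longrightarrow>
      \<exists>!c. (\<forall>g\<in>G. \<forall>h\<in>G. c (g, h) \<in> gr g h) \<and> (\<forall>x. x \<notin> G \<times> G \<longrightarrow> c x = \<zero>\<^bsub>A\<^esub>) \<and>
           finite {x. c x \<noteq> \<zero>\<^bsub>A\<^esub>} \<and> a = (\<Oplus>\<^bsub>A\<^esub>x\<in>{x. c x \<noteq> \<zero>\<^bsub>A\<^esub>}. c x)"
    and comp_mult: "\<lbrakk>g\<^sub>1 \<in> G; h\<^sub>1 \<in> G; g\<^sub>2 \<in> G; h\<^sub>2 \<in> G; a \<in> gr g\<^sub>1 h\<^sub>1; b \<in> gr g\<^sub>2 h\<^sub>2\<rbrakk> \<Longrightarrow>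
      a \<otimes>\<^bsub>A\<^esub> b \<in> gr (gadd g\<^sub>1 g\<^sub>2) (gadd h\<^sub>1 h\<^sub>2)"

text \<open>
  \<open>B\<close> has the underlying vector space of \<open>A\<close>.  Since \<open>B\<close> is an algebra and \<open>A\<close> is the direct sum of
  its components, \<open>deformed_mult\<close> determines the multiplication of \<open>B\<close>.
\<close>

locale bicharacter_deformation = bigraded_algebra K A G gadd gr
  for K :: "('k, 'c) ring_scheme" and A :: "('k, 'a, 'd) module_scheme"
    and G :: "'g set" and gadd :: "'g \<Rightarrow> 'g \<Rightarrow> 'g" and gr :: "'g \<Rightarrow> 'g \<Rightarrow> 'a set" +
  fixes \<phi> \<psi> :: "'g \<Rightarrow> 'g \<Rightarrow> 'k" and B :: "('k, 'a, 'e) module_scheme"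
  assumes bicharacters: "bicharacter K G gadd \<phi>" "bicharacter K G gadd \<psi>"
    and deformed_algebra: "assoc_algebra K B"
    and same_carrier: "carrier B = carrier A"
    and same_add: "\<lbrakk>a \<in> carrier A; b \<in> carrier A\<rbrakk> \<Longrightarrow> a \<oplus>\<^bsub>B\<^esub> b = a \<oplus>\<^bsub>A\<^esub> b"
    and same_smult: "\<lbrakk>c \<in> carrier K; a \<in> carrier A\<rbrakk> \<Longrightarrow> c \<odot>\<^bsub>B\<^esub> a = c \<odot>\<^bsub>A\<^esub> a"
    and deformed_mult: "\<lbrakk>g\<^sub>1 \<in> G; h\<^sub>1 \<in> G; g\<^sub>2 \<in> G; h\<^sub>2 \<in> G; a \<in> gr g\<^sub>1 h\<^sub>1; b \<in> gr g\<^sub>2 h\<^sub>2\<rbrakk> \<Longrightarrow>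
      a \<otimes>\<^bsub>B\<^esub> b = (\<phi> g\<^sub>1 g\<^sub>2 \<otimes>\<^bsub>K\<^esub> \<psi> h\<^sub>1 h\<^sub>2) \<odot>\<^bsub>A\<^esub> (a \<otimes>\<^bsub>A\<^esub> b)"

end

theory Submission
  imports Defs "HOL-Algebra.Weak_Morphisms" "HOL-Library.Function_Algebras" "HOL-Library.Product_Plus"
begin

text \<open>
  Give \<open>Z\<^sub>i\<^sub>j\<close> the bidegree \<open>(e\<^sub>i, e\<^sub>j)\<close>, and let \<open>\<phi>\<close> and \<open>\<psi>\<close> be the bicharacters with
  \<open>\<phi>(e\<^sub>i, e\<^sub>j) = p\<^sub>i\<^sub>j\<close> and \<open>\<psi>(e\<^sub>i, e\<^sub>j) = q\<^sub>i\<^sub>j\<close>; as these are antisymmetric, reversing a product of two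
  generators contributes the squares in the relations.
  The deformed multiplication of the free algebra is isomorphic to the original one through the
  diagonal map that multiplies a word by the product of the values of \<open>\<phi> \<psi>\<close> over all pairs of its
  letters. This map sends each defining relation of \<open>O\<^bsub>q,P,Q\<^esub>\<close> to a nonzero multiple of the
  corresponding relation of \<open>D\<^sub>q\<close>. Since the relations are homogeneous, it therefore maps the one ideal
  onto the other, and transporting the multiplication of \<open>O\<^bsub>q,P,Q\<^esub>\<close> along the induced bijection of
  the quotients gives the deformation of \<open>D\<^sub>q\<close>.
\<close>

section \<open>Quotients and images of algebras\<close>

text \<open>Being a ring depends only on the five shared fields. This carries the library facts
  about \<open>A Quot I\<close> and \<open>image_ring f A\<close> over to the records that extend
  them by a scalar multiplication.\<close>

lemma ring_cong:
  fixes R :: "('a, 'c) ring_scheme" and S :: "('a, 'd) ring_scheme"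
  assumes "ring R" and eqs: "carrier S = carrier R" "monoid.mult S = monoid.mult R" "one S = one R"
    "zero S = zero R" "add S = add R"
  shows "ring S"
proof -
  interpret R: ring R by fact
  show ?thesis
  proof (rule ringI)
    show "abelian_group S"
    proof (rule abelian_groupI)
      fix x assume "x \<in> carrier S"
      then show "\<exists>y\<in>carrier S. y \<oplus>\<^bsub>S\<^esub> x = \<zero>\<^bsub>S\<^esub>"
        using R.a_inv_closed R.l_neg unfolding eqs by blast
    qed (auto simp: eqs R.a_ac)
    show "Group.monoid S"
      by (rule monoidI) (auto simp: eqs R.m_assoc)
  qed (auto simp: eqs R.l_distr R.r_distr)
qed

lemma quotient_algebra_simps:
  "carrier (quotient_algebra A I) = a_rcosets\<^bsub>A\<^esub> I"
  "monoid.mult (quotient_algebra A I) = rcoset_mult A I"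
  "one (quotient_algebra A I) = I +>\<^bsub>A\<^esub> \<one>\<^bsub>A\<^esub>"
  "zero (quotient_algebra A I) = I"
  "add (quotient_algebra A I) = set_add A"
  "module.smult (quotient_algebra A I) = (\<lambda>c C. \<Union>x\<in>C. I +>\<^bsub>A\<^esub> (c \<odot>\<^bsub>A\<^esub> x))"
  by (simp_all add: quotient_algebra_def FactRing_def ring.defs module.defs)

lemma (in ideal) a_r_coset_eq_iff:
  assumes "x \<in> carrier R" "y \<in> carrier R"
  shows "I +> x = I +> y \<longleftrightarrow> x \<ominus> y \<in> I"
  using assms quotient_eq_iff_same_a_r_cos[OF ideal_axioms, of x y] by simp

context assoc_algebra
begin

sublocale ring A by (rule unital_ring)
sublocale vs: module K A by (rule vector_space)

text \<open>Since \<open>c x = (c 1) x\<close>, absorption of products gives absorption of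
  scalars.\<close>

lemma ideal_smult_closed:
  assumes "ideal I A" "c \<in> carrier K" "x \<in> I"
  shows "c \<odot>\<^bsub>A\<^esub> x \<in> I"
proof -
  interpret I: ideal I A by fact
  have x: "x \<in> carrier A" using I.a_Hcarr[OF assms(3)] .
  have "(c \<odot>\<^bsub>A\<^esub> \<one>\<^bsub>A\<^esub>) \<otimes>\<^bsub>A\<^esub> x \<in> I"
    using assms x by (intro I.I_l_closed) auto
  then show ?thesis
    using assms x by (simp add: smult_mult_left)
qed

text \<open>The union in the definition runs over all elements \<open>i + x\<close> of the coset.
  Each contributes the same coset, because \<open>c i\<close> lies in the ideal.\<close>

lemma quotient_smult_coset:
  assumes "ideal I A" "c \<in> carrier K" "x \<in> carrier A"
  shows "c \<odot>\<^bsub>quotient_algebra A I\<^esub> (I +>\<^bsub>A\<^esub> x) = I +>\<^bsub>A\<^esub> (c \<odot>\<^bsub>A\<^esub> x)"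
proof -
  interpret I: ideal I A by fact
  have "I +>\<^bsub>A\<^esub> (c \<odot>\<^bsub>A\<^esub> y) = I +>\<^bsub>A\<^esub> (c \<odot>\<^bsub>A\<^esub> x)" if y: "y \<in> I +>\<^bsub>A\<^esub> x" for y
  proof -
    from y obtain i where i: "i \<in> I" "y = i \<oplus>\<^bsub>A\<^esub> x"
      by (auto simp: a_r_coset_def r_coset_def)
    have ic: "i \<in> carrier A" using i(1) by (rule I.a_Hcarr)
    have "c \<odot>\<^bsub>A\<^esub> y \<ominus>\<^bsub>A\<^esub> c \<odot>\<^bsub>A\<^esub> x = c \<odot>\<^bsub>A\<^esub> i"
      using assms ic i(2) by (simp add: vs.smult_r_distr a_minus_def a_assoc r_neg)
    then show ?thesis
      using assms ic i ideal_smult_closed[OF assms(1,2) i(1)]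
      by (subst I.a_r_coset_eq_iff) auto
  qed
  moreover have "x \<in> I +>\<^bsub>A\<^esub> x"
    using assms by (intro I.a_rcos_self)
  ultimately have "(\<Union>y\<in>I +>\<^bsub>A\<^esub> x. I +>\<^bsub>A\<^esub> (c \<odot>\<^bsub>A\<^esub> y)) = I +>\<^bsub>A\<^esub> (c \<odot>\<^bsub>A\<^esub> x)"
    by blast
  then show ?thesis by (simp only: quotient_algebra_simps)
qed

lemma assoc_algebra_quotient:
  assumes "ideal I A"
  shows "assoc_algebra K (quotient_algebra A I)"
proof -
  interpret I: ideal I A by fact
  let ?Q = "quotient_algebra A I"
  have ring: "ring ?Q"
    by (rule ring_cong[OF I.quotient_is_ring]) (simp_all add: quotient_algebra_simps FactRing_def)
  have carrier: "carrier ?Q = (\<lambda>x. I +>\<^bsub>A\<^esub> x) ` carrier A"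
    by (auto simp: quotient_algebra_simps A_RCOSETS_defs a_r_coset_def)
  have add: "(I +>\<^bsub>A\<^esub> x) \<oplus>\<^bsub>?Q\<^esub> (I +>\<^bsub>A\<^esub> y) = I +>\<^bsub>A\<^esub> (x \<oplus>\<^bsub>A\<^esub> y)"
    if "x \<in> carrier A" "y \<in> carrier A" for x y
    using that by (simp add: quotient_algebra_simps I.a_rcos_sum)
  have mult: "(I +>\<^bsub>A\<^esub> x) \<otimes>\<^bsub>?Q\<^esub> (I +>\<^bsub>A\<^esub> y) = I +>\<^bsub>A\<^esub> (x \<otimes>\<^bsub>A\<^esub> y)"
    if "x \<in> carrier A" "y \<in> carrier A" for x y
    using that by (simp add: quotient_algebra_simps I.rcoset_mult_add)
  note smult = quotient_smult_coset[OF assms]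
  show ?thesis
  proof (rule assoc_algebra.intro)
    show "module K ?Q"
    proof (rule moduleI)
      show "abelian_group ?Q" using ring by (rule ring.is_abelian_group)
    qed (auto simp: carrier add smult vs.smult_l_distr vs.smult_r_distr vs.smult_assoc1 vs.R.is_cring)
  qed (use ring scalar_field in \<open>auto simp: carrier mult smult smult_mult_left smult_mult_right\<close>)
qed

end

text \<open>Transport of structure along \<open>f\<close>, meant for \<open>f\<close> injective on
  the carrier, where \<open>inv_into\<close> is a true inverse. The deformed algebra is obtained in
  this way.\<close>

definition image_algebra :: "('a \<Rightarrow> 'b) \<Rightarrow> ('k, 'a, 'd) module_scheme \<Rightarrow> ('k, 'b) module"
  where "image_algebra f A =
    ring.extend (image_ring f A) (module.fields (\<lambda>c y. f (c \<odot>\<^bsub>A\<^esub> inv_into (carrier A) f y)))"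

lemma image_algebra_simps:
  "carrier (image_algebra f A) = f ` carrier A"
  "one (image_algebra f A) = f \<one>\<^bsub>A\<^esub>"
  "zero (image_algebra f A) = f \<zero>\<^bsub>A\<^esub>"
  by (simp_all add: image_algebra_def image_ring_def image_group_def monoid.defs ring.defs module.defs)

lemma image_algebra_ops:
  assumes "inj_on f (carrier A)" "x \<in> carrier A"
  shows "y \<in> carrier A \<Longrightarrow> f x \<otimes>\<^bsub>image_algebra f A\<^esub> f y = f (x \<otimes>\<^bsub>A\<^esub> y)"
    and "y \<in> carrier A \<Longrightarrow> f x \<oplus>\<^bsub>image_algebra f A\<^esub> f y = f (x \<oplus>\<^bsub>A\<^esub> y)"
    and "c \<odot>\<^bsub>image_algebra f A\<^esub> f x = f (c \<odot>\<^bsub>A\<^esub> x)"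
  using assms
  by (simp_all add: image_algebra_def image_ring_def image_group_def monoid.defs ring.defs module.defs)

lemma (in assoc_algebra) assoc_algebra_image:
  assumes inj: "inj_on f (carrier A)"
  shows "assoc_algebra K (image_algebra f A)"
proof -
  let ?B = "image_algebra f A"
  have ring: "ring ?B"
    by (rule ring_cong[OF inj_imp_image_ring_is_ring[OF inj]])
      (simp_all add: image_algebra_def image_ring_def image_group_def monoid.defs ring.defs module.defs)
  note ops = image_algebra_simps image_algebra_ops[OF inj]
  show ?thesis
  proof (rule assoc_algebra.intro)
    show "module K ?B"
    proof (rule moduleI)
      show "abelian_group ?B" using ring by (rule ring.is_abelian_group)
    qed (auto simp: ops vs.smult_l_distr vs.smult_r_distr vs.smult_assoc1 vs.R.is_cring)
  qed (use ring scalar_field in \<open>auto simp: ops smult_mult_left smult_mult_right\<close>)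
qed

lemma (in assoc_algebra) image_algebra_iso:
  assumes inj: "inj_on f (carrier A)"
  shows "f \<in> algebra_iso K A (image_algebra f A)"
  using inj
  by (auto simp: algebra_iso_def ring_iso_def bij_betw_def image_algebra_simps
      image_algebra_ops[OF inj] intro!: ring_hom_memI)


section \<open>The free algebra and presented algebras\<close>

lemma ring_of_type_algebra_simps [simp]:
  "carrier ring_of_type_algebra = UNIV"
  "monoid.mult ring_of_type_algebra = (*)"
  "one ring_of_type_algebra = 1"
  "zero ring_of_type_algebra = 0"
  "add ring_of_type_algebra = (+)"
  by (simp_all add: ring_of_type_algebra_def)

lemma free_algebra_simps [simp]:
  "carrier free_algebra = UNIV"
  "monoid.mult free_algebra = (*)"
  "one free_algebra = 1"
  "zero free_algebra = 0"
  "add free_algebra = (+)"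
  "module.smult free_algebra = scale"
  by (simp_all add: free_algebra_def ring_of_type_algebra_def ring.defs module.defs)

lemma scale_conv_mult: "scale c f = Poly_Mapping.single 0 c * f"
  by (simp add: scale_def mult_map_scale_conv_mult)

text \<open>Reduces additive statements about the free algebra to multiples of a single
  word.\<close>

lemma poly_mapping_single_add_induct [case_names single add]:
  assumes "\<And>w c. P (Poly_Mapping.single w c)" and "\<And>f g. P f \<Longrightarrow> P g \<Longrightarrow> P (f + g)"
  shows "P (f :: 'a \<Rightarrow>\<^sub>0 'b::comm_monoid_add)"
proof (induction f rule: update_induct)
  case const
  \<comment> \<open>The zero function is a single term with coefficient 0.\<close>
  show ?case using assms(1)[of undefined 0] by simp
next
  case (update f a b)
  have "Poly_Mapping.update a b f = f + Poly_Mapping.single a b"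
    using update(1) by (intro poly_mapping_eqI) (auto simp: lookup_update lookup_add lookup_single in_keys_iff when_def)
  then show ?case using assms update by simp
qed

text \<open>The diagonal map with eigenvalue \<open>h w\<close> at \<open>w\<close>. Both the
  projections to homogeneous components and the twist are instances.\<close>

definition weight :: "('a \<Rightarrow> 'k) \<Rightarrow> ('a \<Rightarrow>\<^sub>0 'k) \<Rightarrow> ('a \<Rightarrow>\<^sub>0 'k::mult_zero)"
  where "weight h f = Abs_poly_mapping (\<lambda>w. h w * poly_mapping.lookup f w)"

lemma lookup_weight [simp]: "poly_mapping.lookup (weight h f) w = h w * poly_mapping.lookup f w"
proof -
  have "finite {w. h w * poly_mapping.lookup f w \<noteq> 0}"
    by (rule finite_subset[OF _ finite_lookup[of f]]) auto
  then show ?thesis by (simp add: weight_def)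
qed

lemma lookup_scale [simp]: "poly_mapping.lookup (scale c f) w = c * poly_mapping.lookup f w"
  by (simp add: scale_def Poly_Mapping.map.rep_eq when_def)

lemma weight_zero [simp]: "weight h 0 = 0"
  by (rule poly_mapping_eqI) simp

lemma weight_single: "weight h (Poly_Mapping.single w c) = Poly_Mapping.single w (h w * c)"
  by (rule poly_mapping_eqI) (simp add: lookup_single when_def)

lemma weight_add: "weight h (f + g) = weight h f + (weight h g :: 'a \<Rightarrow>\<^sub>0 'k::semiring_0)"
  by (rule poly_mapping_eqI) (simp add: lookup_add algebra_simps)

lemma weight_diff: "weight h (f - g) = weight h f - (weight h g :: 'a \<Rightarrow>\<^sub>0 'k::ring)"
  by (rule poly_mapping_eqI) (simp add: lookup_minus algebra_simps)

lemma weight_scale: "weight h (scale c f) = scale c (weight h f)"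
  by (rule poly_mapping_eqI) simp

lemma weight_sum: "weight h (sum f A) = (\<Sum>x\<in>A. weight h (f x) :: 'a \<Rightarrow>\<^sub>0 'k::semiring_0)"
  by (induction A rule: infinite_finite_induct) (auto simp: weight_add)

lemma scale_add: "scale c (f + g) = scale c f + scale c g"
  and scale_diff: "scale c (f - g) = scale c f - scale c g"
  and scale_add_left: "scale (c + d) f = scale c f + scale d f"
  and scale_scale: "scale c (scale d f) = scale (c * d) f"
  and scale_one [simp]: "scale 1 f = f"
  and scale_zero [simp]: "scale c 0 = 0"
  and scale_single: "scale c (Poly_Mapping.single w a) = Poly_Mapping.single w (c * a)"
  by (rule poly_mapping_eqI; simp add: lookup_add lookup_minus algebra_simps lookup_single when_def)+

lemma scale_mult_left: "scale c f * g = scale c (f * g)"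
  by (simp add: scale_conv_mult mult.assoc)

text \<open>Scalars are the multiples of the empty word, which commutes with every word.\<close>

lemma scale_mult_right: "f * scale c g = scale c (f * g)"
proof -
  have "f * Poly_Mapping.single 0 c = Poly_Mapping.single 0 c * f"
    by (induction f rule: poly_mapping_single_add_induct) (auto simp: algebra_simps mult_single)
  then show ?thesis
    by (simp add: scale_conv_mult flip: mult.assoc)
qed

lemma ring_free_algebra: "ring (free_algebra :: ('k::field, ('x, 'k) free_alg) module)"
proof (rule ringI)
  show "abelian_group (free_algebra :: ('k, ('x, 'k) free_alg) module)"
  proof (rule abelian_groupI)
    fix x :: "('x, 'k) free_alg"
    show "\<exists>y\<in>carrier free_algebra. y \<oplus>\<^bsub>free_algebra\<^esub> x = \<zero>\<^bsub>free_algebra\<^esub>"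
      by (auto intro: exI[of _ "- x"])
  qed (auto simp: algebra_simps)
  show "Group.monoid (free_algebra :: ('k, ('x, 'k) free_alg) module)"
    by (rule monoidI) (auto simp: algebra_simps)
qed (auto simp: algebra_simps)

lemma assoc_algebra_free_algebra: "assoc_algebra ring_of_type_algebra free_algebra"
proof (rule assoc_algebra.intro)
  show "module ring_of_type_algebra free_algebra"
    using ring_free_algebra cring_from_type_algebra
    by (intro moduleI) (auto simp: ring_def scale_add scale_add_left scale_scale)
qed (auto simp: ring_free_algebra field_from_type_algebra scale_mult_left scale_mult_right)

interpretation free: assoc_algebra ring_of_type_algebra free_algebra
  by (rule assoc_algebra_free_algebra)

lemma free_algebra_a_minus [simp]: "f \<ominus>\<^bsub>free_algebra\<^esub> g = f - g"
proof -
  have "\<ominus>\<^bsub>free_algebra\<^esub> g = - g"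
    using free.minus_equality[of "- g" g] by simp
  then show ?thesis by (simp add: a_minus_def)
qed

lemma ideal_free_algebraI:
  assumes "0 \<in> I" "\<And>f g. f \<in> I \<Longrightarrow> g \<in> I \<Longrightarrow> f + g \<in> I"
    and "\<And>f g. f \<in> I \<Longrightarrow> g * f \<in> I" "\<And>f g. f \<in> I \<Longrightarrow> f * g \<in> I"
  shows "ideal I free_algebra"
proof (rule idealI)
  \<comment> \<open>Closure under negation comes from multiplication by -1.\<close>
  have minus: "- f \<in> I" if "f \<in> I" for f using assms(3)[OF that, of "- 1"] by simp
  show "subgroup I (add_monoid free_algebra)"
  proof (rule group.subgroupI)
    show "group (add_monoid free_algebra)" using free.add.is_group .
    fix f assume "f \<in> I"
    then show "inv\<^bsub>add_monoid free_algebra\<^esub> f \<in> I"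
      using minus free.minus_equality[of "- f" f] by (simp add: a_inv_def)
  next
    show "I \<noteq> {}" using assms(1) by blast
  qed (simp_all add: assms)
qed (simp_all add: assms ring_free_algebra)

lemma ideal_free_algebraD:
  assumes "ideal I free_algebra"
  shows "0 \<in> I" "f \<in> I \<Longrightarrow> g \<in> I \<Longrightarrow> f + g \<in> I" "f \<in> I \<Longrightarrow> h * f \<in> I" "f \<in> I \<Longrightarrow> f * h \<in> I"
    and "f \<in> I \<Longrightarrow> scale c f \<in> I" "f \<in> I \<Longrightarrow> g \<in> I \<Longrightarrow> f - g \<in> I" "(\<And>x. x \<in> S \<Longrightarrow> k x \<in> I) \<Longrightarrow> sum k S \<in> I"
proof -
  interpret I: ideal I free_algebra by fact
  show 0: "0 \<in> I" using I.zero_closed by simp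
  show add: "f + g \<in> I" if "f \<in> I" "g \<in> I" for f g using I.a_closed that by simp
  show l: "h * f \<in> I" if "f \<in> I" for f h using I.I_l_closed that by simp
  show "f \<in> I \<Longrightarrow> f * h \<in> I" using I.I_r_closed by simp
  show "f \<in> I \<Longrightarrow> scale c f \<in> I" using l by (simp add: scale_conv_mult)
  show "f - g \<in> I" if "f \<in> I" "g \<in> I"
    using add[OF that(1) l[OF that(2), of "-1"]] by simp
  show "(\<And>x. x \<in> S \<Longrightarrow> k x \<in> I) \<Longrightarrow> sum k S \<in> I"
    by (induction S rule: infinite_finite_induct) (auto simp: 0 intro!: add)
qed

section \<open>Presented algebras computed on representatives\<close>

abbreviation relation_ideal :: "('x, 'k::field) free_alg set \<Rightarrow> ('x, 'k) free_alg set"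
  where "relation_ideal R \<equiv> genideal free_algebra R"

abbreviation residue_class :: "('x, 'k::field) free_alg set \<Rightarrow> ('x, 'k) free_alg \<Rightarrow> ('x, 'k) free_alg set"
  where "residue_class R f \<equiv> relation_ideal R +>\<^bsub>free_algebra\<^esub> f"

lemma relation_ideal: "ideal (relation_ideal R) free_algebra"
  by (rule free.genideal_ideal) simp

lemma relation_idealI: "r \<in> R \<Longrightarrow> r \<in> relation_ideal R"
  using free.genideal_self[of R] by auto

lemma relation_ideal_minimal: "ideal I free_algebra \<Longrightarrow> R \<subseteq> I \<Longrightarrow> relation_ideal R \<subseteq> I"
  by (rule free.genideal_minimal)

lemma residue_class_eq_iff: "residue_class R f = residue_class R g \<longleftrightarrow> f - g \<in> relation_ideal R"
  using ideal.a_r_coset_eq_iff[OF relation_ideal, of f g R] by simp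

lemma presented_algebra_simps:
  "carrier (presented_algebra R) = range (residue_class R)"
  "one (presented_algebra R) = residue_class R 1"
  "zero (presented_algebra R) = residue_class R 0"
  "residue_class R f \<otimes>\<^bsub>presented_algebra R\<^esub> residue_class R g = residue_class R (f * g)"
  "residue_class R f \<oplus>\<^bsub>presented_algebra R\<^esub> residue_class R g = residue_class R (f + g)"
  "c \<odot>\<^bsub>presented_algebra R\<^esub> residue_class R f = residue_class R (scale c f)"
proof -
  interpret I: ideal "relation_ideal R" free_algebra by (rule relation_ideal)
  show "carrier (presented_algebra R) = range (residue_class R)"
    by (auto simp: presented_algebra_def quotient_algebra_simps A_RCOSETS_defs a_r_coset_def)
  show "one (presented_algebra R) = residue_class R 1"
    by (simp add: presented_algebra_def quotient_algebra_simps)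
  show "zero (presented_algebra R) = residue_class R 0"
    by (simp add: presented_algebra_def quotient_algebra_simps a_r_coset_def r_coset_def)
  show "residue_class R f \<otimes>\<^bsub>presented_algebra R\<^esub> residue_class R g = residue_class R (f * g)"
    using I.rcoset_mult_add[of f g] by (simp add: presented_algebra_def quotient_algebra_simps)
  show "residue_class R f \<oplus>\<^bsub>presented_algebra R\<^esub> residue_class R g = residue_class R (f + g)"
    using I.a_rcos_sum[of f g] by (simp add: presented_algebra_def quotient_algebra_simps)
  show "c \<odot>\<^bsub>presented_algebra R\<^esub> residue_class R f = residue_class R (scale c f)"
    using free.quotient_smult_coset[OF relation_ideal, of c f] by (simp add: presented_algebra_def)
qed

lemma assoc_algebra_presented: "assoc_algebra ring_of_type_algebra (presented_algebra R)"
  unfolding presented_algebra_def by (rule free.assoc_algebra_quotient[OF relation_ideal])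

section \<open>Gradings and diagonal twists\<close>

text \<open>Degrees lie in a group, so that a component of a product with a word \<open>w\<close>
  can be located by subtracting \<open>grade w\<close>.\<close>

locale word_grading =
  fixes grade :: "'x word \<Rightarrow> 'g::ab_group_add"
  assumes grade_plus: "grade (u + v) = grade u + grade v"
begin

definition component :: "'g \<Rightarrow> ('x, 'k::field) free_alg \<Rightarrow> ('x, 'k) free_alg"
  where "component d = weight (\<lambda>w. if grade w = d then 1 else 0)"

lemma lookup_component [simp]:
  "poly_mapping.lookup (component d f) w = (if grade w = d then poly_mapping.lookup f w else 0)"
  by (simp add: component_def)

lemma component_zero [simp]: "component d 0 = 0"
  by (simp add: component_def)

lemma component_add: "component d (f + g) = component d f + component d g"
  by (simp add: component_def weight_add)

lemma component_diff: "component d (f - g) = component d f - component d g"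
  by (simp add: component_def weight_diff)

lemma component_sum: "component d (sum f A) = (\<Sum>x\<in>A. component d (f x))"
  by (simp add: component_def weight_sum)

lemma component_scale: "component d (scale c f) = scale c (component d f)"
  by (simp add: component_def weight_scale)

lemma component_weight: "component d (weight h f) = weight h (component d f)"
  by (rule poly_mapping_eqI) simp

lemma component_single:
  "component d (Poly_Mapping.single w c) = (if grade w = d then Poly_Mapping.single w c else 0)"
  by (auto simp: component_def weight_single)

lemma component_component: "component d (component e f) = (if d = e then component d f else 0)"
  by (rule poly_mapping_eqI) auto

lemma component_eq_0:
  assumes "d \<notin> grade ` Poly_Mapping.keys f"
  shows "component d f = 0"
  using assms by (intro poly_mapping_eqI) (auto simp: in_keys_iff)

lemma sum_component: "(\<Sum>d\<in>grade ` Poly_Mapping.keys f. component d f) = f"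
  by (rule poly_mapping_eqI) (auto simp: lookup_sum in_keys_iff)

lemma component_single_mult:
  "component d (Poly_Mapping.single w c * f) = Poly_Mapping.single w c * component (d - grade w) f"
  by (induction f rule: poly_mapping_single_add_induct)
    (auto simp: mult_single component_single component_add grade_plus algebra_simps)

lemma component_mult_single:
  "component d (f * Poly_Mapping.single w c) = component (d - grade w) f * Poly_Mapping.single w c"
  by (induction f rule: poly_mapping_single_add_induct)
    (auto simp: mult_single component_single component_add grade_plus algebra_simps)

text \<open>Homogeneity of products, phrased with projections of arbitrary elements so that an
  additive induction on \<open>f\<close> goes through.\<close>

lemma component_component_mult:
  "component (d + e) (component d f * component e g) = component d f * component e g"
proof (induction f rule: poly_mapping_single_add_induct)
  case (single w c)
  then show ?case by (auto simp: component_single component_single_mult component_component)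
qed (simp add: component_add distrib_right)

end

text \<open>On words, \<open>beta\<close> of the degrees is the coboundary of \<open>chi\<close>.
  This is why deforming the free algebra by \<open>beta\<close> yields an isomorphic
  algebra.\<close>

locale word_twist = word_grading grade for grade :: "'x word \<Rightarrow> 'g::ab_group_add" +
  fixes chi :: "'x word \<Rightarrow> 'k::field" and beta :: "'g \<Rightarrow> 'g \<Rightarrow> 'k"
  assumes chi_plus: "chi (u + v) = chi u * chi v * beta (grade u) (grade v)"
    and chi_nonzero: "chi w \<noteq> 0"
begin

definition twist :: "('x, 'k) free_alg \<Rightarrow> ('x, 'k) free_alg"
  where "twist = weight chi"

definition untwist :: "('x, 'k) free_alg \<Rightarrow> ('x, 'k) free_alg"
  where "untwist = weight (\<lambda>w. inverse (chi w))"

lemma untwist_twist [simp]: "untwist (twist f) = f"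
  by (rule poly_mapping_eqI) (simp add: twist_def untwist_def chi_nonzero)

lemma twist_untwist [simp]: "twist (untwist f) = f"
  by (rule poly_mapping_eqI) (simp add: twist_def untwist_def chi_nonzero)

lemma twist_zero [simp]: "twist 0 = 0"
  by (simp add: twist_def)

lemma twist_add: "twist (f + g) = twist f + twist g"
  by (simp add: twist_def weight_add)

lemma twist_scale: "twist (scale c f) = scale c (twist f)"
  by (simp add: twist_def weight_scale)

lemma twist_sum: "twist (sum f A) = (\<Sum>x\<in>A. twist (f x))"
  by (simp add: twist_def weight_sum)

lemma twist_single: "twist (Poly_Mapping.single w c) = Poly_Mapping.single w (chi w * c)"
  by (simp add: twist_def weight_single)

text \<open>On two words of degrees \<open>d\<close> and \<open>e\<close> this is
  \<open>chi_plus\<close>; words of other degrees are killed by the projections, and both sides are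
  biadditive.\<close>

lemma twist_component_mult:
  "twist (component d f * component e g) =
    scale (beta d e) (twist (component d f) * twist (component e g))"
proof (induction f rule: poly_mapping_single_add_induct)
  case (single u a)
  show ?case
  proof (induction g rule: poly_mapping_single_add_induct)
    case (single v b)
    show ?case
      by (auto simp: component_single mult_single twist_single scale_single chi_plus mult_ac)
  qed (simp add: component_add twist_add scale_add distrib_left)
qed (simp add: component_add twist_add scale_add distrib_right)

lemma twist_mult:
  assumes "component d f = f" "component e g = g"
  shows "twist (f * g) = scale (beta d e) (twist f * twist g)"
  using twist_component_mult[of d f e g] by (simp add: assms)

lemma word_twist_inverse: "word_twist grade (\<lambda>w. inverse (chi w)) (\<lambda>d e. inverse (beta d e))"
  by unfold_locales (simp_all add: chi_plus chi_nonzero)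

text \<open>
  Although \<^const>\<open>twist\<close> is not multiplicative, the elements all of whose homogeneous components
  are mapped into the ideal \<open>I\<close> form an ideal.
\<close>

lemma twist_component_in_ideal:
  assumes I: "ideal I free_algebra"
    and R: "\<And>r. r \<in> R \<Longrightarrow> \<exists>d. component d r = r \<and> twist r \<in> I"
    and f: "f \<in> relation_ideal R"
  shows "twist (component d f) \<in> I"
proof -
  define J where "J = {f. \<forall>d. twist (component d f) \<in> I}"
  have "ideal J free_algebra"
  proof (rule ideal_free_algebraI)
    show "0 \<in> J" using ideal_free_algebraD(1)[OF I] by (simp add: J_def twist_def)
    show add: "f + g \<in> J" if "f \<in> J" "g \<in> J" for f g
      using that ideal_free_algebraD(2)[OF I] by (simp add: J_def component_add twist_add)
    show "g * f \<in> J" if f: "f \<in> J" for f g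
    \<comment> \<open>By additivity the factor is a multiple of one word \<open>w\<close>; then the
      degree \<open>d\<close> part of the product involves only the degree
      \<open>d - grade w\<close> part of \<open>f\<close>.\<close>
    proof (induction g rule: poly_mapping_single_add_induct)
      case (single w c)
      have "twist (component d (Poly_Mapping.single w c * f)) \<in> I" for d
      proof -
        have "component d (Poly_Mapping.single w c * f) =
            component (grade w) (Poly_Mapping.single w c) * component (d - grade w) f"
          by (simp add: component_single_mult component_single)
        moreover have "twist (component (d - grade w) f) \<in> I" using f by (simp add: J_def)
        ultimately show ?thesis
          by (simp add: twist_component_mult ideal_free_algebraD(3,5)[OF I])
      qed
      then show ?case by (simp add: J_def)
    qed (simp add: distrib_right add)
    show "f * g \<in> J" if f: "f \<in> J" for f g
    proof (induction g rule: poly_mapping_single_add_induct)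
      case (single w c)
      have "twist (component d (f * Poly_Mapping.single w c)) \<in> I" for d
      proof -
        have "component d (f * Poly_Mapping.single w c) =
            component (d - grade w) f * component (grade w) (Poly_Mapping.single w c)"
          by (simp add: component_mult_single component_single)
        moreover have "twist (component (d - grade w) f) \<in> I" using f by (simp add: J_def)
        ultimately show ?thesis
          by (simp add: twist_component_mult ideal_free_algebraD(4,5)[OF I])
      qed
      then show ?case by (simp add: J_def)
    qed (simp add: distrib_left add)
  qed
  moreover have "R \<subseteq> J"
  proof
    fix r assume "r \<in> R"
    then obtain d where d: "component d r = r" "twist r \<in> I" using R by blast
    \<comment> \<open>A homogeneous relation is its own component in degree \<open>d\<close>, and
      its other components vanish.\<close>
    have "twist (component e r) \<in> I" for e
      using component_component[of e d r] d ideal_free_algebraD(1)[OF I]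
      by (cases "e = d") (simp_all add: twist_def)
    then show "r \<in> J" by (simp add: J_def)
  qed
  ultimately have "f \<in> J" using f relation_ideal_minimal by blast
  then show ?thesis by (simp add: J_def)
qed

text \<open>The element \<open>f\<close> is the sum of its finitely many components, and
  \<open>twist\<close> is additive.\<close>

lemma twist_in_ideal:
  assumes I: "ideal I free_algebra"
    and R: "\<And>r. r \<in> R \<Longrightarrow> \<exists>d. component d r = r \<and> twist r \<in> I"
    and f: "f \<in> relation_ideal R"
  shows "twist f \<in> I"
proof -
  have "(\<Sum>d\<in>grade ` Poly_Mapping.keys f. twist (component d f)) \<in> I"
    by (intro ideal_free_algebraD(7)[OF I] twist_component_in_ideal[OF assms])
  then show ?thesis by (simp add: sum_component flip: twist_sum)
qed

end

section \<open>Grading of an algebra presented by homogeneous relations\<close>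

context word_grading
begin

definition homogeneous_relations :: "('x, 'k::field) free_alg set \<Rightarrow> bool"
  where "homogeneous_relations R \<longleftrightarrow> (\<forall>r\<in>R. \<exists>d. component d r = r)"

text \<open>The case of \<open>twist_component_in_ideal\<close> in which \<open>chi\<close> and
  \<open>beta\<close> are constantly 1 and the twist is the identity. It lets the quotient inherit
  the grading.\<close>

lemma component_in_relation_ideal:
  fixes f :: "('x, 'k::field) free_alg"
  assumes R: "homogeneous_relations R" and f: "f \<in> relation_ideal R"
  shows "component d f \<in> relation_ideal R"
proof -
  interpret word_twist grade "\<lambda>_. 1 :: 'k" "\<lambda>_ _. 1"
    by unfold_locales simp_all
  have [simp]: "twist f = f" for f
    by (rule poly_mapping_eqI) (simp add: twist_def)
  show ?thesis
    using twist_component_in_ideal[OF relation_ideal _ f] R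
    by (auto simp: homogeneous_relations_def intro: relation_idealI)
qed

end

text \<open>A class belongs here as soon as one of its representatives is homogeneous of bidegree
  \<open>(g, h)\<close>.\<close>

definition homogeneous_classes ::
    "('x word \<Rightarrow> 'g::ab_group_add \<times> 'g) \<Rightarrow> ('x, 'k::field) free_alg set \<Rightarrow> 'g \<Rightarrow> 'g \<Rightarrow> ('x, 'k) free_alg set set"
  where "homogeneous_classes grade R g h =
    residue_class R ` {f. word_grading.component grade (g, h) f = f}"

lemma finsum_residue_class:
  assumes "finite S"
  shows "(\<Oplus>\<^bsub>presented_algebra R\<^esub>x\<in>S. residue_class R (k x)) = residue_class R (sum k S)"
proof -
  interpret assoc_algebra ring_of_type_algebra "presented_algebra R"
    by (rule assoc_algebra_presented)
  show ?thesis
    using assms by (induction S) (auto simp: presented_algebra_simps)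
qed

text \<open>Decompositions exist because they do in the free algebra; they are unique because the
  ideal contains the components of its elements.\<close>

lemma bigraded_presented_algebra:
  fixes grade :: "'x word \<Rightarrow> 'g::ab_group_add \<times> 'g" and R :: "('x, 'k::field) free_alg set"
  assumes "word_grading grade" and R: "word_grading.homogeneous_relations grade R"
  shows "bigraded_algebra ring_of_type_algebra (presented_algebra R) (UNIV :: 'g set) (+)
    (homogeneous_classes grade R)"
proof -
  interpret word_grading grade by fact
  let ?A = "presented_algebra R"
  interpret A: assoc_algebra ring_of_type_algebra ?A
    by (rule assoc_algebra_presented)
  note simps = presented_algebra_simps
  show ?thesis
  proof (intro bigraded_algebra.intro bigraded_algebra_axioms.intro A.assoc_algebra_axioms)
    show "abelian_semigroup (UNIV :: 'g set) (+)"
      by unfold_locales (simp_all add: ac_simps)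
  next
    fix g h :: 'g
    show "submodule (homogeneous_classes grade R g h) ring_of_type_algebra ?A"
    proof (rule A.vs.submoduleI)
      show "c \<odot>\<^bsub>?A\<^esub> x \<in> homogeneous_classes grade R g h"
        if "x \<in> homogeneous_classes grade R g h" for c x
        using that by (auto simp: homogeneous_classes_def simps component_scale)
      show "homogeneous_classes grade R g h \<subseteq> carrier ?A"
        by (auto simp: homogeneous_classes_def simps)
      show "\<zero>\<^bsub>?A\<^esub> \<in> homogeneous_classes grade R g h"
        by (auto simp: homogeneous_classes_def simps intro!: image_eqI[of _ _ 0])
      show "\<ominus>\<^bsub>?A\<^esub> a \<in> homogeneous_classes grade R g h" if a: "a \<in> homogeneous_classes grade R g h" for a
      proof -
        from a obtain f where f: "a = residue_class R f" "component (g, h) f = f"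
          by (auto simp: homogeneous_classes_def)
        have "\<ominus>\<^bsub>?A\<^esub> a = residue_class R (- f)"
          by (rule A.minus_equality) (simp_all add: f simps)
        then show ?thesis
          using f component_diff[of "(g, h)" 0 f] by (auto simp: homogeneous_classes_def)
      qed
      show "a \<oplus>\<^bsub>?A\<^esub> b \<in> homogeneous_classes grade R g h"
        if "a \<in> homogeneous_classes grade R g h" "b \<in> homogeneous_classes grade R g h" for a b
        using that by (auto simp: homogeneous_classes_def simps component_add)
    qed
  next
    fix g1 h1 g2 h2 :: 'g and a b
    assume "a \<in> homogeneous_classes grade R g1 h1" "b \<in> homogeneous_classes grade R g2 h2"
    then obtain f1 f2 where f: "a = residue_class R f1" "component (g1, h1) f1 = f1"
        "b = residue_class R f2" "component (g2, h2) f2 = f2"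
      by (auto simp: homogeneous_classes_def)
    then have "component (g1 + g2, h1 + h2) (f1 * f2) = f1 * f2"
      using component_component_mult[of "(g1, h1)" "(g2, h2)" f1 f2] by simp
    with f show "a \<otimes>\<^bsub>?A\<^esub> b \<in> homogeneous_classes grade R (g1 + g2) (h1 + h2)"
      by (auto simp: homogeneous_classes_def simps)
  next
    fix a assume "a \<in> carrier ?A"
    then obtain f where a: "a = residue_class R f" by (auto simp: simps)
    define c where "c x = residue_class R (component x f)" for x
    show "\<exists>!c. (\<forall>g\<in>UNIV. \<forall>h\<in>UNIV. c (g, h) \<in> homogeneous_classes grade R g h) \<and>
        (\<forall>x. x \<notin> UNIV \<times> UNIV \<longrightarrow> c x = \<zero>\<^bsub>?A\<^esub>) \<and>
        finite {x. c x \<noteq> \<zero>\<^bsub>?A\<^esub>} \<and> a = (\<Oplus>\<^bsub>?A\<^esub>x\<in>{x. c x \<noteq> \<zero>\<^bsub>?A\<^esub>}. c x)"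
    proof (rule ex1I[of _ c], intro conjI)
      show "\<forall>g\<in>UNIV. \<forall>h\<in>UNIV. c (g, h) \<in> homogeneous_classes grade R g h"
        by (auto simp: c_def homogeneous_classes_def component_component)
      \<comment> \<open>A component of \<open>f\<close> may lie in the ideal, so the support of
        \<open>c\<close> can be smaller than the set of degrees occurring in \<open>f\<close>; the
        additional summands are zero.\<close>
      have sub: "{x. c x \<noteq> \<zero>\<^bsub>?A\<^esub>} \<subseteq> grade ` Poly_Mapping.keys f"
        using component_eq_0[of _ f] by (auto simp: c_def simps)
      then show "finite {x. c x \<noteq> \<zero>\<^bsub>?A\<^esub>}" by (rule finite_subset) simp
      have "(\<Oplus>\<^bsub>?A\<^esub>x\<in>{x. c x \<noteq> \<zero>\<^bsub>?A\<^esub>}. c x) = (\<Oplus>\<^bsub>?A\<^esub>x\<in>grade ` Poly_Mapping.keys f. c x)"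
        using sub by (intro A.add.finprod_mono_neutral_cong_left) (auto simp: c_def simps)
      then show "a = (\<Oplus>\<^bsub>?A\<^esub>x\<in>{x. c x \<noteq> \<zero>\<^bsub>?A\<^esub>}. c x)"
        by (simp add: c_def finsum_residue_class sum_component a)
    next
      fix c' assume c': "(\<forall>g\<in>UNIV. \<forall>h\<in>UNIV. c' (g, h) \<in> homogeneous_classes grade R g h) \<and>
        (\<forall>x. x \<notin> UNIV \<times> UNIV \<longrightarrow> c' x = \<zero>\<^bsub>?A\<^esub>) \<and>
        finite {x. c' x \<noteq> \<zero>\<^bsub>?A\<^esub>} \<and> a = (\<Oplus>\<^bsub>?A\<^esub>x\<in>{x. c' x \<noteq> \<zero>\<^bsub>?A\<^esub>}. c' x)"
      define S where "S = {x. c' x \<noteq> \<zero>\<^bsub>?A\<^esub>}"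
      have "\<exists>f'. c' x = residue_class R f' \<and> component x f' = f'" for x
      proof -
        have "c' x \<in> homogeneous_classes grade R (fst x) (snd x)"
          using c' by (cases x) simp
        then show ?thesis by (auto simp: homogeneous_classes_def)
      qed
      \<comment> \<open>Homogeneous representatives move the comparison into the free
        algebra.\<close>
      then obtain k where k: "\<And>x. c' x = residue_class R (k x)" "\<And>x. component x (k x) = k x"
        by metis
      have S: "finite S" using c' by (simp add: S_def)
      have "c' = (\<lambda>x. residue_class R (k x))" using k(1) by blast
      moreover have "a = (\<Oplus>\<^bsub>?A\<^esub>x\<in>S. c' x)" using c' by (simp only: S_def)
      ultimately have "a = residue_class R (sum k S)"
        using S by (simp only: finsum_residue_class)
      then have diff: "f - sum k S \<in> relation_ideal R"
        by (simp add: a residue_class_eq_iff)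
      show "c' = c"
      proof
        fix y
        have "component y (k x) = (if x = y then k y else 0)" for x
          using component_component[of y x "k x"] k(2)[of x] by (cases "x = y") simp_all
        then have y: "component y (sum k S) = (if y \<in> S then k y else 0)"
          using S by (simp add: component_sum)
        \<comment> \<open>Projecting the difference to degree \<open>y\<close> stays in the ideal
          and isolates one summand. For \<open>y\<close> outside \<open>S\<close>, the class
          \<open>c' y\<close> is zero by the choice of \<open>S\<close>.\<close>
        have "component y f - (if y \<in> S then k y else 0) \<in> relation_ideal R"
          using component_in_relation_ideal[OF R diff, of y] by (simp add: component_diff y)
        then have "c y = residue_class R (if y \<in> S then k y else 0)"
          by (simp add: c_def residue_class_eq_iff)
        then show "c' y = c y"
          by (cases "y \<in> S") (simp_all add: k(1) S_def simps(3))
      qed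
    qed simp
  qed
qed

text \<open>The general criterion: if the twist matches the relations \<open>R'\<close> with
  \<open>R\<close> up to scalars, it maps one ideal onto the other and induces a bijection of the
  quotients. Transport of structure along it gives \<open>B\<close>.\<close>

lemma bicharacter_deformation_twist:
  fixes grade :: "'x word \<Rightarrow> 'g::ab_group_add \<times> 'g" and R R' :: "('x, 'k::field) free_alg set"
  assumes "word_twist grade chi (\<lambda>d e. \<phi> (fst d) (fst e) * \<psi> (snd d) (snd e))"
    and bicharacters: "bicharacter ring_of_type_algebra UNIV (+) \<phi>"
      "bicharacter ring_of_type_algebra UNIV (+) \<psi>"
    and homogeneous: "word_grading.homogeneous_relations grade R'"
    and R': "\<And>r'. r' \<in> R' \<Longrightarrow> \<exists>c. \<exists>r\<in>R. weight chi r' = scale c r"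
    and R: "\<And>r. r \<in> R \<Longrightarrow> \<exists>c. c \<noteq> 0 \<and> (\<exists>r'\<in>R'. weight chi r' = scale c r)"
  shows "\<exists>B :: ('k, ('x, 'k) free_alg set) module.
    bicharacter_deformation ring_of_type_algebra (presented_algebra R) UNIV (+)
      (homogeneous_classes grade R) \<phi> \<psi> B \<and>
    algebra_iso ring_of_type_algebra (presented_algebra R') B \<noteq> {}"
proof -
  interpret word_twist grade chi "\<lambda>d e. \<phi> (fst d) (fst e) * \<psi> (snd d) (snd e)" by fact
  interpret inv: word_twist grade "\<lambda>w. inverse (chi w)"
    "\<lambda>d e. inverse (\<phi> (fst d) (fst e) * \<psi> (snd d) (snd e))"
    by (rule word_twist_inverse)
  have inv_twist: "inv.twist = untwist"
    by (simp add: inv.twist_def untwist_def)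
  have homogeneous_R': "\<exists>d. component d r = r" if "r \<in> R'" for r
    using homogeneous that by (auto simp: homogeneous_relations_def)
  \<comment> \<open>Division by the nonzero scalar turns each relation in \<open>R\<close> into a
    multiple of a twisted relation.\<close>
  have R_untwist: "\<exists>c. \<exists>r'\<in>R'. r = scale c (twist r')" if "r \<in> R" for r
  proof -
    from R[OF that] obtain c r' where "c \<noteq> 0" "r' \<in> R'" "twist r' = scale c r"
      by (auto simp: twist_def)
    then have "r = scale (inverse c) (twist r')" by (simp add: scale_scale)
    with \<open>r' \<in> R'\<close> show ?thesis by blast
  qed
  \<comment> \<open>Diagonal maps commute with the projections, so homogeneity passes from
    \<open>R'\<close> to \<open>R\<close>.\<close>
  have homogeneous_R: "\<exists>d. component d r = r" if r: "r \<in> R" for r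
  proof -
    obtain c r' where *: "r' \<in> R'" "r = scale c (twist r')" using R_untwist[OF r] by blast
    moreover obtain d where "component d r' = r'" using homogeneous_R' *(1) by blast
    ultimately have "component d r = r"
      by (simp add: component_scale component_weight twist_def)
    then show ?thesis ..
  qed
  have twist_ideal: "twist f \<in> relation_ideal R" if "f \<in> relation_ideal R'" for f
  proof (rule twist_in_ideal[OF relation_ideal _ that])
    fix r assume r: "r \<in> R'"
    then obtain c s where "s \<in> R" "twist r = scale c s" using R'[OF r] by (auto simp: twist_def)
    then have "twist r \<in> relation_ideal R"
      using ideal_free_algebraD(5)[OF relation_ideal] relation_idealI by metis
    with homogeneous_R'[OF r] show "\<exists>d. component d r = r \<and> twist r \<in> relation_ideal R"
      by blast
  qed
  \<comment> \<open>The inverse of the twist is the twist for the inverse data, so the same argument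
    gives the reverse inclusion.\<close>
  have untwist_ideal: "untwist f \<in> relation_ideal R'" if "f \<in> relation_ideal R" for f
  proof (rule inv.twist_in_ideal[OF relation_ideal _ that, unfolded inv_twist])
    fix r assume r: "r \<in> R"
    then obtain c r' where *: "r' \<in> R'" "r = twist (scale c r')" 
      using R_untwist[OF r] by (auto simp: twist_scale)
    then have "untwist r \<in> relation_ideal R'"
      using ideal_free_algebraD(5)[OF relation_ideal] relation_idealI by (metis untwist_twist)
    with homogeneous_R[OF r] show "\<exists>d. component d r = r \<and> untwist r \<in> relation_ideal R'"
      by blast
  qed
  have image_ideal: "twist ` relation_ideal R' = relation_ideal R"
  proof
    show "twist ` relation_ideal R' \<subseteq> relation_ideal R" using twist_ideal by blast
    show "relation_ideal R \<subseteq> twist ` relation_ideal R'"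
    proof
      fix f assume "f \<in> relation_ideal R"
      then show "f \<in> twist ` relation_ideal R'"
        using untwist_ideal by (intro image_eqI[of _ _ "untwist f"]) simp_all
    qed
  qed
  \<comment> \<open>A class is a translate of the ideal, so the direct image under the additive map
    \<open>twist\<close> is again a class. Direct image is therefore the induced map of the
    quotients.\<close>
  have image_class: "twist ` residue_class R' f = residue_class R (twist f)" for f
  proof -
    have translate: "residue_class S g = (\<lambda>i. i + g) ` relation_ideal S" for S and g :: "('x, 'k) free_alg"
      by (auto simp: a_r_coset_def r_coset_def)
    show ?thesis
      unfolding translate unfolding image_ideal[symmetric] by (simp add: image_image twist_add)
  qed
  let ?K = "ring_of_type_algebra :: 'k ring"
  let ?A' = "presented_algebra R'"
  let ?A = "presented_algebra R"
  let ?B = "image_algebra ((`) twist) ?A'"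
  interpret A': assoc_algebra ?K ?A' by (rule assoc_algebra_presented)
  have inj: "inj_on ((`) twist) (carrier ?A')"
  proof -
    have "inj twist" by (rule inj_on_inverseI[of _ untwist]) simp
    then show ?thesis by (intro inj_onI) (simp add: inj_image_eq_iff)
  qed
  \<comment> \<open>The class of \<open>f\<close> is the image of the class of
    \<open>untwist f\<close>. Since \<open>twist\<close> is linear, only the product
    changes.\<close>
  have ops:
    "residue_class R f \<otimes>\<^bsub>?B\<^esub> residue_class R g = residue_class R (twist (untwist f * untwist g))"
    "residue_class R f \<oplus>\<^bsub>?B\<^esub> residue_class R g = residue_class R (f + g)"
    "c \<odot>\<^bsub>?B\<^esub> residue_class R f = residue_class R (scale c f)" for f g c
    using image_algebra_ops(1,2)[OF inj, of "residue_class R' (untwist f)" "residue_class R' (untwist g)"]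
      image_algebra_ops(3)[OF inj, of "residue_class R' (untwist f)" c]
    by (simp_all add: presented_algebra_simps image_class twist_add twist_scale)
  have "bicharacter_deformation ?K ?A UNIV (+) (homogeneous_classes grade R) \<phi> \<psi> ?B"
  proof (intro bicharacter_deformation.intro bicharacter_deformation_axioms.intro)
    show "bigraded_algebra ?K ?A UNIV (+) (homogeneous_classes grade R)"
      using homogeneous_R word_grading_axioms
      by (intro bigraded_presented_algebra) (auto simp: homogeneous_relations_def)
    show "assoc_algebra ?K ?B" by (rule A'.assoc_algebra_image[OF inj])
    have "range twist = UNIV" by (rule surjI[of _ untwist]) simp
    then have "range (\<lambda>f. residue_class R (twist f)) = range (residue_class R)"
      using image_image[of "residue_class R" twist UNIV] by simp
    then show "carrier ?B = carrier ?A"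
      by (simp add: image_algebra_simps presented_algebra_simps image_image image_class)
  next
    fix g1 h1 g2 h2 a b
    assume "a \<in> homogeneous_classes grade R g1 h1" "b \<in> homogeneous_classes grade R g2 h2"
    then obtain f1 f2 where f: "a = residue_class R f1" "component (g1, h1) f1 = f1"
        "b = residue_class R f2" "component (g2, h2) f2 = f2"
      by (auto simp: homogeneous_classes_def)
    \<comment> \<open>Untwisting keeps degrees, so \<open>twist_mult\<close> applies with the
      bidegrees of \<open>f1\<close> and \<open>f2\<close> and produces exactly the two bicharacter
      values.\<close>
    have "component d (untwist f) = untwist f" if "component d f = f" for d f
      using that by (simp add: untwist_def component_weight)
    then have "twist (untwist f1 * untwist f2) = scale (\<phi> g1 g2 * \<psi> h1 h2) (f1 * f2)"
      using twist_mult[of "(g1, h1)" "untwist f1" "(g2, h2)" "untwist f2"] f(2,4)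
      by simp
    then show "a \<otimes>\<^bsub>?B\<^esub> b = (\<phi> g1 g2 \<otimes>\<^bsub>?K\<^esub> \<psi> h1 h2) \<odot>\<^bsub>?A\<^esub> (a \<otimes>\<^bsub>?A\<^esub> b)"
      by (simp add: f ops presented_algebra_simps)
  qed (auto simp: bicharacters presented_algebra_simps ops)
  moreover have "(`) twist \<in> algebra_iso ?K ?A' ?B"
    by (rule A'.image_algebra_iso[OF inj])
  ultimately show ?thesis by blast
qed

section \<open>The bidegree and the bicharacters of the quantum matrix algebras\<close>

text \<open>For bimultiplicative \<open>beta\<close> this is the product of \<open>beta\<close> over
  all pairs of letters, earlier letter first: each letter is paired with the total degree of the
  letters after it.\<close>

primrec cocycle_chain :: "('x word \<Rightarrow> 'g) \<Rightarrow> ('g \<Rightarrow> 'g \<Rightarrow> 'k::comm_monoid_mult) \<Rightarrow> 'x list \<Rightarrow> 'k"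
  where
    "cocycle_chain grade beta [] = 1"
  | "cocycle_chain grade beta (x # xs) =
      beta (grade (Word [x])) (grade (Word xs)) * cocycle_chain grade beta xs"

text \<open>The pairs of letters in a concatenation are those inside either factor, counted by the
  two chains, and the mixed ones, counted by \<open>beta\<close> of the two degrees.\<close>

lemma word_twist_cocycle_chain:
  fixes grade :: "'x word \<Rightarrow> 'g::ab_group_add" and beta :: "'g \<Rightarrow> 'g \<Rightarrow> 'k::field"
  assumes "word_grading grade"
    and add_left: "\<And>d d' e. beta (d + d') e = beta d e * beta d' e"
    and add_right: "\<And>d e e'. beta d (e + e') = beta d e * beta d e'"
    and nonzero: "\<And>d e. beta d e \<noteq> 0"
  shows "word_twist grade (\<lambda>w. cocycle_chain grade beta (letters w)) beta"
proof -
  interpret word_grading grade by fact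
  let ?chi = "cocycle_chain grade beta"
  have grade_Cons: "grade (Word (x # xs)) = grade (Word [x]) + grade (Word xs)" for x xs
    using grade_plus[of "Word [x]" "Word xs"] by (simp add: plus_word_def)
  have grade_Nil: "grade (Word []) = 0"
    using grade_plus[of "Word []" "Word []"] by (simp add: plus_word_def)
  \<comment> \<open>The value \<open>beta 0 e\<close> is nonzero and equal to its own
    square.\<close>
  have zero_left: "beta 0 e = 1" for e
    using add_left[of 0 0 e] nonzero[of 0 e] by simp
  have append: "?chi (xs @ ys) = ?chi xs * ?chi ys * beta (grade (Word xs)) (grade (Word ys))" for xs ys
  proof (induction xs)
    case (Cons x xs)
    have "grade (Word (xs @ ys)) = grade (Word xs) + grade (Word ys)"
      using grade_plus[of "Word xs" "Word ys"] by (simp add: plus_word_def)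
    then show ?case
      by (simp add: Cons.IH grade_Cons[of x xs] add_left add_right mult_ac)
  qed (simp add: grade_Nil zero_left)
  have "?chi xs \<noteq> 0" for xs
    by (induction xs) (simp_all add: nonzero)
  then show ?thesis
    using append by unfold_locales (simp_all add: plus_word_def)
qed

text \<open>The standard basis vectors of the grading group Z^n.\<close>

definition unit_weight :: "'n \<Rightarrow> 'n \<Rightarrow> int"
  where "unit_weight i = (\<lambda>k. if k = i then 1 else 0)"

definition bidegree :: "('n \<times> 'n) word \<Rightarrow> ('n \<Rightarrow> int) \<times> ('n \<Rightarrow> int)"
  where "bidegree w = (\<Sum>(i, j)\<leftarrow>letters w. (unit_weight i, unit_weight j))"

text \<open>The extension to Z^n of prescribed values \<open>m i j\<close> on pairs of basis
  vectors. Exponents can be negative; nonzero entries make it additive in each argument.\<close>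

definition matrix_bicharacter ::
    "('n::finite \<Rightarrow> 'n \<Rightarrow> 'k::field) \<Rightarrow> ('n \<Rightarrow> int) \<Rightarrow> ('n \<Rightarrow> int) \<Rightarrow> 'k"
  where "matrix_bicharacter m g h = (\<Prod>i\<in>UNIV. \<Prod>j\<in>UNIV. m i j powi (g i * h j))"

lemma word_grading_bidegree: "word_grading bidegree"
  by unfold_locales (simp add: bidegree_def plus_word_def)

text \<open>All factors except the one at \<open>(i, j)\<close> have exponent 0.\<close>

lemma matrix_bicharacter_unit_weight:
  "matrix_bicharacter m (unit_weight i) (unit_weight j) = m i j"
proof -
  have "m i' j' powi (unit_weight i i' * unit_weight j j') =
      (if i' = i then if j' = j then m i j else 1 else 1)" for i' j'
    by (simp add: unit_weight_def)
  then show ?thesis by (simp add: matrix_bicharacter_def prod.If_cases)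
qed

context
  fixes m :: "'n::finite \<Rightarrow> 'n \<Rightarrow> 'k::field"
  assumes nonzero: "\<And>i j. m i j \<noteq> 0"
begin

lemma matrix_bicharacter_add_left:
  "matrix_bicharacter m (g + g') h = matrix_bicharacter m g h * matrix_bicharacter m g' h"
  by (simp add: matrix_bicharacter_def nonzero distrib_right power_int_add prod.distrib)

lemma matrix_bicharacter_add_right:
  "matrix_bicharacter m g (h + h') = matrix_bicharacter m g h * matrix_bicharacter m g h'"
  by (simp add: matrix_bicharacter_def nonzero distrib_left power_int_add prod.distrib)

lemma matrix_bicharacter_nonzero: "matrix_bicharacter m g h \<noteq> 0"
  by (simp add: matrix_bicharacter_def nonzero)

lemma bicharacter_matrix_bicharacter:
  "bicharacter ring_of_type_algebra UNIV (+) (matrix_bicharacter m)"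
proof -
  have "x \<in> Units (ring_of_type_algebra :: 'k ring)" if "x \<noteq> 0" for x :: 'k
    using that by (auto simp: Units_def intro!: exI[of _ "inverse x"])
  then show ?thesis
    by (simp add: bicharacter_def matrix_bicharacter_add_left matrix_bicharacter_add_right
        matrix_bicharacter_nonzero)
qed

end

section \<open>The twist on quadratic monomials and on the relations\<close>

definition matrix_twist ::
    "('n::finite \<Rightarrow> 'n \<Rightarrow> 'k::field) \<Rightarrow> ('n \<Rightarrow> 'n \<Rightarrow> 'k) \<Rightarrow> ('n \<times> 'n) word \<Rightarrow> 'k"
  where "matrix_twist p r w = cocycle_chain bidegree
    (\<lambda>d e. matrix_bicharacter p (fst d) (fst e) * matrix_bicharacter r (snd d) (snd e)) (letters w)"

lemma Z_mult_Z: "Z s t * Z i j = Poly_Mapping.single (Word [(s, t), (i, j)]) 1"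
  by (simp add: gen_def mult_single plus_word_def)

lemma weight_matrix_twist_Z_mult_Z:
  assumes "\<And>i j. p i j \<noteq> 0" "\<And>i j. r i j \<noteq> 0"
  shows "weight (matrix_twist p r) (Z s t * Z i j) = scale (p s i * r t j) (Z s t * Z i j)"
proof -
  \<comment> \<open>The second letter is followed by the empty word, of bidegree 0, and contributes
    only this trivial factor.\<close>
  have "matrix_bicharacter m g 0 = 1" for m :: "'a \<Rightarrow> 'a \<Rightarrow> 'b" and g
    by (simp add: matrix_bicharacter_def)
  then show ?thesis
    by (simp add: Z_mult_Z weight_single scale_single matrix_twist_def bidegree_def
        matrix_bicharacter_unit_weight)
qed

text \<open>All monomials of one relation use the same two row indices and the same two column
  indices.\<close>

lemma homogeneous_multiparam_relations:
  "word_grading.homogeneous_relations bidegree (multiparam_relations q p r)"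
proof -
  interpret word_grading bidegree by (rule word_grading_bidegree)
  have Z: "component d (Z s t * Z i j) =
      (if d = (unit_weight s + unit_weight i, unit_weight t + unit_weight j) then Z s t * Z i j else 0)"
    for d s t i j
    by (auto simp: Z_mult_Z component_single bidegree_def)
  show ?thesis
    unfolding homogeneous_relations_def
  proof
    fix x assume "x \<in> multiparam_relations q p r"
    then show "\<exists>d. component d x = x"
      unfolding multiparam_relations_def
    proof (elim UnE CollectE exE conjE, goal_cases)
      case (1 s t i j)
      then show ?case
        by (intro exI[of _ "(unit_weight s + unit_weight i, unit_weight t + unit_weight j)"])
          (simp add: component_diff component_add component_scale Z add.commute)
    next
      case (2 s t i j)
      then show ?case
        by (intro exI[of _ "(unit_weight s + unit_weight i, unit_weight t + unit_weight j)"])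
          (simp add: component_diff component_scale Z add.commute)
    next
      case (3 i j t)
      then show ?case
        by (intro exI[of _ "(unit_weight i + unit_weight i, unit_weight t + unit_weight j)"])
          (simp add: component_diff component_scale Z add.commute)
    qed
  qed
qed

context
  fixes p r :: "'n::{finite,linorder} \<Rightarrow> 'n \<Rightarrow> 'k::field" and q :: 'k
  assumes nonzero: "p i j \<noteq> 0" "r i j \<noteq> 0"
    and antisym: "p j i = inverse (p i j)" "r j i = inverse (r i j)"
    and diagonal: "p i i = 1"
begin

text \<open>The twist multiplies \<open>Z s t * Z i j\<close> by \<open>p s i * r t j\<close>, the
  reversed product by the inverse of this, and \<open>Z i t * Z s j\<close> by
  \<open>p i s * r t j\<close>. Relative to the first factor, the others absorb exactly the squares
  in the relations. In the third family the row factor is \<open>p i i = 1\<close>.\<close>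

lemma weight_matrix_twist_relations:
  shows "weight (matrix_twist p r)
      (Z s t * Z i j - (scale ((p s i)\<^sup>2 * (r t j)\<^sup>2) (Z i j * Z s t)
                      + scale ((q\<^sup>2 - 1) * (p s i)\<^sup>2) (Z i t * Z s j))) =
      scale (p s i * r t j) (Z s t * Z i j - (Z i j * Z s t + scale (q\<^sup>2 - 1) (Z i t * Z s j)))"
    and "weight (matrix_twist p r)
      (Z s t * Z i j - scale (q\<^sup>2 * (p s i)\<^sup>2 * inverse ((r j t)\<^sup>2)) (Z i j * Z s t)) =
      scale (p s i * r t j) (Z s t * Z i j - scale (q\<^sup>2) (Z i j * Z s t))"
    and "weight (matrix_twist p r) (Z i t * Z i j - scale ((r t j)\<^sup>2) (Z i j * Z i t)) =
      scale (r t j) (Z i t * Z i j - Z i j * Z i t)"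
proof -
  note inverses = antisym(1)[of i s] antisym(2)[of j t]
  \<comment> \<open>In each line, a coefficient times the twist factor of its monomial equals the
    common scalar times the Dipper-Donkin coefficient.\<close>
  have coeffs: "(p s i)\<^sup>2 * (r t j)\<^sup>2 * (p i s * r j t) = p s i * r t j"
    "(q\<^sup>2 - 1) * (p s i)\<^sup>2 * (p i s * r t j) = p s i * r t j * (q\<^sup>2 - 1)"
    "q\<^sup>2 * (p s i)\<^sup>2 * inverse ((r j t)\<^sup>2) * (p i s * r j t) = p s i * r t j * q\<^sup>2"
    "(r t j)\<^sup>2 * r j t = r t j"
    by (simp_all add: inverses nonzero power2_eq_square field_simps)
  show "weight (matrix_twist p r)
      (Z s t * Z i j - (scale ((p s i)\<^sup>2 * (r t j)\<^sup>2) (Z i j * Z s t)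
                      + scale ((q\<^sup>2 - 1) * (p s i)\<^sup>2) (Z i t * Z s j))) =
      scale (p s i * r t j) (Z s t * Z i j - (Z i j * Z s t + scale (q\<^sup>2 - 1) (Z i t * Z s j)))"
    "weight (matrix_twist p r)
      (Z s t * Z i j - scale (q\<^sup>2 * (p s i)\<^sup>2 * inverse ((r j t)\<^sup>2)) (Z i j * Z s t)) =
      scale (p s i * r t j) (Z s t * Z i j - scale (q\<^sup>2) (Z i j * Z s t))"
    "weight (matrix_twist p r) (Z i t * Z i j - scale ((r t j)\<^sup>2) (Z i j * Z i t)) =
      scale (r t j) (Z i t * Z i j - Z i j * Z i t)"
    by (simp_all add: weight_diff weight_add weight_scale weight_matrix_twist_Z_mult_Z nonzero
        scale_diff scale_add scale_scale diagonal coeffs)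
qed

lemma multiparam_relation_twist:
  assumes "x \<in> multiparam_relations q p r"
  shows "\<exists>c. \<exists>y\<in>Dipper_Donkin_relations q. weight (matrix_twist p r) x = scale c y"
  using assms unfolding multiparam_relations_def Dipper_Donkin_relations_def
proof (elim UnE CollectE exE conjE, goal_cases)
  case (1 s t i j)
  show ?case
    unfolding 1(1) by (rule exI, rule bexI, rule weight_matrix_twist_relations(1)) (use 1(2,3) in blast)
next
  case (2 s t i j)
  show ?case
    unfolding 2(1) by (rule exI, rule bexI, rule weight_matrix_twist_relations(2)) (use 2(2,3) in blast)
next
  case (3 i j t)
  show ?case
    unfolding 3(1) by (rule exI, rule bexI, rule weight_matrix_twist_relations(3)) blast
qed

text \<open>Serves the reverse inclusion of ideals, which divides by the scalar; the scalar is built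
  from nonzero entries of \<open>p\<close> and \<open>r\<close>.\<close>

lemma Dipper_Donkin_relation_twist:
  assumes "y \<in> Dipper_Donkin_relations q"
  shows "\<exists>c. c \<noteq> 0 \<and> (\<exists>x\<in>multiparam_relations q p r. weight (matrix_twist p r) x = scale c y)"
  using assms unfolding multiparam_relations_def Dipper_Donkin_relations_def
proof (elim UnE CollectE exE conjE, goal_cases)
  case (1 s t i j)
  have nz: "p s i * r t j \<noteq> 0" by (simp add: nonzero)
  show ?case
    unfolding 1(1)
    by (rule exI, rule conjI, rule nz, rule bexI, rule weight_matrix_twist_relations(1))
      (use 1(2,3) in blast)
next
  case (2 s t i j)
  have nz: "p s i * r t j \<noteq> 0" by (simp add: nonzero)
  show ?case
    unfolding 2(1)
    by (rule exI, rule conjI, rule nz, rule bexI, rule weight_matrix_twist_relations(2))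
      (use 2(2,3) in blast)
next
  case (3 i j t)
  show ?case
    unfolding 3(1)
    by (rule exI, rule conjI, rule nonzero(2), rule bexI, rule weight_matrix_twist_relations(3)) blast
qed

end

section \<open>The parameters in the field of rational functions, and the conclusion\<close>

lemma indet_fract_nonzero: "indet_fract (v :: 'a::linorder indet) \<noteq> 0"
proof -
  have "Poly_Mapping.single m (1 :: rat) \<noteq> 0" for m :: "'a indet \<Rightarrow>\<^sub>0 nat"
    by (metis lookup_single_eq lookup_zero zero_neq_one)
  then show ?thesis by (simp add: indet_fract_def Zero_fract_def eq_fract)
qed

lemma multiparam_nonzero: "multiparam b i j \<noteq> 0"
  by (simp add: multiparam_def indet_fract_nonzero)

lemma multiparam_swap: "multiparam b j i = inverse (multiparam b i j)"
  by (auto simp: multiparam_def)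

lemma multiparam_same: "multiparam b i i = 1"
  by (simp add: multiparam_def)

theorem proposition3p2:
  shows "\<exists>(G :: ('n::{finite,linorder} \<Rightarrow> int) set) gadd gr \<phi> \<psi> (B :: 'n matrix_algebra).
    bicharacter_deformation (ring_of_type_algebra :: 'n rat_fun ring) (D_q :: 'n matrix_algebra)
      G gadd gr \<phi> \<psi> B \<and>
    algebra_iso (ring_of_type_algebra :: 'n rat_fun ring) (O_qPQ :: 'n matrix_algebra) B \<noteq> {}"
proof -
  let ?\<phi> = "matrix_bicharacter (Pvar :: 'n \<Rightarrow> 'n \<Rightarrow> 'n rat_fun)"
  let ?\<psi> = "matrix_bicharacter (Qvar :: 'n \<Rightarrow> 'n \<Rightarrow> 'n rat_fun)"
  note bichar = multiparam_nonzero matrix_bicharacter_add_left matrix_bicharacter_add_right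
    matrix_bicharacter_nonzero
  have twist: "word_twist bidegree (matrix_twist Pvar Qvar)
      (\<lambda>d e. ?\<phi> (fst d) (fst e) * ?\<psi> (snd d) (snd e))"
    unfolding matrix_twist_def
    by (rule word_twist_cocycle_chain[OF word_grading_bidegree]) (simp_all add: bichar)
  \<comment> \<open>The semigroup is all of Z^n. The multiparameter relations play the part of
    \<open>R'\<close>, the Dipper-Donkin relations that of \<open>R\<close>.\<close>
  have "\<exists>B :: 'n matrix_algebra.
      bicharacter_deformation ring_of_type_algebra D_q UNIV (+)
        (homogeneous_classes bidegree (Dipper_Donkin_relations qvar)) ?\<phi> ?\<psi> B \<and>
      algebra_iso ring_of_type_algebra O_qPQ B \<noteq> {}"
    unfolding D_q_def O_qPQ_def
  proof (rule bicharacter_deformation_twist[OF twist])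
    show "bicharacter ring_of_type_algebra UNIV (+) ?\<phi>" "bicharacter ring_of_type_algebra UNIV (+) ?\<psi>"
      by (rule bicharacter_matrix_bicharacter, rule multiparam_nonzero)+
    show "word_grading.homogeneous_relations bidegree (multiparam_relations qvar Pvar Qvar)"
      by (rule homogeneous_multiparam_relations)
    \<comment> \<open>The order is that of the assumptions on \<open>p\<close> and \<open>r\<close>;
      \<open>rotated -1\<close> below moves the membership premise in front of them.\<close>
    note multiparam = multiparam_nonzero multiparam_nonzero multiparam_swap multiparam_swap
      multiparam_same
    show "\<exists>c. \<exists>y\<in>Dipper_Donkin_relations qvar. weight (matrix_twist Pvar Qvar) x = scale c y"
      if "x \<in> multiparam_relations qvar Pvar Qvar" for x
      using that by (rule multiparam_relation_twist[rotated -1, OF _ multiparam])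
    show "\<exists>c. c \<noteq> 0 \<and> (\<exists>x\<in>multiparam_relations qvar Pvar Qvar.
        weight (matrix_twist Pvar Qvar) x = scale c y)"
      if "y \<in> Dipper_Donkin_relations qvar" for y
      using that by (rule Dipper_Donkin_relation_twist[rotated -1, OF _ multiparam])
  qed
  then show ?thesis by blast
qed

end
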